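(* Let $G$ be Graham's number and let $N := \operatorname{slog}_3(G)$. For every positive integer $c$, the following hold. (i) $^{N+c}3 - G \equiv 4\cdot 10^{N-1} \pmod{10^{N}}$. In particular, the $N$-th rightmost decimal digit of $3^{G} - G$ is $4$. (ii) Let $d$ be the $N$-th rightmost decimal digit of $G$ and let $d'$ be the $N$-th rightmost decimal digit of $^{N+c}3$. Then $d - d' = 6$ if $d \in \{6,7,8,9\}$, and $d - d' = -4$ otherwise.
   Context: Integer tetration: for positive integers $a,b$, define $^{1}a := a$ and $^{b}a := a^{(^{b-1}a)}$ for $b \ge 2$ (so $^{b}a$ is a power tower of $b$ copies of $a$). Knuth's up-arrow notation, for positive integers $a,b,k$: $a\uparrow^{1} b := a^b$, $a \uparrow^{k+1} 1 := a$, and $a\uparrow^{k+1} b := a \uparrow^{k} (a\uparrow^{k+1}(b-1))$ for $b\ge 2$; thus $a\uparrow^{2} b = {}^{b}a$. Graham's number: $g_1 := 3\uparrow^{4} 3$ and $g_k := 3\uparrow^{g_{k-1}} 3$ for $k\ge 2$; Graham's number is $G := g_{64}$. There is a unique positive integer $N$ with $^{N}3 = G$. Integer super-logarithm in base $3$: $\operatorname{slog}_3(1) := 0$ and $\operatorname{slog}_3(3^q) := \operatorname{slog}_3(q)+1$ for positive integers $q$ for which $\operatorname{slog}_3(q)$ is defined. Hence $\operatorname{slog}_3({}^{k}3) = k$ for every positive integer $k$, and $\operatorname{slog}_3(G)$ is the unique positive integer $N$ with $^{N}3=G$. Digit positions are counted from right to left starting at $1$: the $k$-th rightmost decimal digit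 of a nonnegative integer $x$ is $\lfloor x/10^{k-1}\rfloor \bmod 10$. *)

theory Defs
  imports "HOL-Number_Theory.Cong"
begin

text \<open>
  The functions below are only specified on positive arguments, as in the mathematical
  definitions; the omitted patterns carry no information.
\<close>

fun tetration :: "nat \<Rightarrow> nat \<Rightarrow> nat" where
  "tetration a (Suc 0) = a"
| "tetration a (Suc (Suc b)) = a ^ tetration a (Suc b)"

text \<open>\<open>up_arrow a k b\<close> has \<open>k\<close> arrows between \<open>a\<close> and \<open>b\<close>.\<close>

fun up_arrow :: "nat \<Rightarrow> nat \<Rightarrow> nat \<Rightarrow> nat" where
  "up_arrow a (Suc 0) b = a ^ b"
| "up_arrow a (Suc (Suc k)) (Suc 0) = a"
| "up_arrow a (Suc (Suc k)) (Suc (Suc b)) =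
     up_arrow a (Suc k) (up_arrow a (Suc (Suc k)) (Suc b))"

fun graham_seq :: "nat \<Rightarrow> nat" where
  "graham_seq (Suc 0) = up_arrow 3 4 3"
| "graham_seq (Suc (Suc k)) = up_arrow 3 (graham_seq (Suc k)) 3"

definition graham :: nat where
  "graham = graham_seq 64"

text \<open>
  The integer super-logarithm in base 3 is a partial function, so it is given by its graph
  \<open>is_slog3\<close>; single-valuedness is shown in \<open>is_slog3_unique\<close>.
\<close>

inductive is_slog3 :: "nat \<Rightarrow> nat \<Rightarrow> bool" where
  one: "is_slog3 1 0"
| pow: "q > 0 \<Longrightarrow> is_slog3 q n \<Longrightarrow> is_slog3 (3 ^ q) (n + 1)"

definition slog3 :: "nat \<Rightarrow> nat" where
  "slog3 x = (THE n. is_slog3 x n)"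

lemma is_slog3_unique: "is_slog3 x m \<Longrightarrow> is_slog3 x n \<Longrightarrow> m = n"
proof (induction arbitrary: n rule: is_slog3.induct)
  case one
  then show ?case
  proof (cases rule: is_slog3.cases)
    case (pow q k)
    then have "(3::nat) ^ q = 1" "q > 0" by simp_all
    then show ?thesis by simp
  qed simp
next
  case (pow q m)
  from pow.prems show ?case
  proof (cases rule: is_slog3.cases)
    case one
    with pow.hyps show ?thesis by simp
  next
    case (pow q' n')
    then have "q' = q" by simp
    with pow pow.IH show ?thesis by simp
  qed
qed

lemma slog3_eqI: "is_slog3 x n \<Longrightarrow> slog3 x = n"
  unfolding slog3_def by (blast intro: is_slog3_unique)

lemma slog3_tetration:
  assumes "k > 0"
  shows "slog3 (tetration 3 k) = k"
proof -
  have "tetration 3 (Suc j) > 0 \<and> is_slog3 (tetration 3 (Suc j)) (Suc j)" for j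
  proof (induction j)
    case 0
    show ?case using is_slog3.pow[OF _ is_slog3.one] by simp
  next
    case (Suc j)
    then show ?case using is_slog3.pow[of "tetration 3 (Suc j)" "Suc j"] by simp
  qed
  then show ?thesis using assms slog3_eqI by (cases k) auto
qed

text \<open>The \<open>k\<close>-th decimal digit counted from the right, starting at \<open>k = 1\<close>.\<close>

definition digit :: "nat \<Rightarrow> nat \<Rightarrow> nat" where
  "digit k x = (x div 10 ^ (k - 1)) mod 10"

end

theory Submission imports Defs
begin

text \<open>
  Write \<open>T n\<close> for the tower of \<open>n\<close> threes. The idea is to follow the gap between consecutive towers
  modulo powers of 10. Raising 3 to an exponent amplifies decimal closeness: for even \<open>t\<close> and
  \<open>k \<ge> 1\<close>, the power \<open>3 ^ (10 ^ k * t)\<close> is \<open>1 + 10 ^ (k + 1) * (2 * t)\<close> modulo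
  \<open>10 ^ (k + 2)\<close> (\<open>three_power_even\<close>), which comes from \<open>3 ^ 20 = 1 + 400\<close> modulo 1000
  by repeatedly taking tenth powers.
  Hence if \<open>T (n + 1) = T n + 10 ^ (n - 1) * t\<close>, then
  \<open>T (n + 2) = T (n + 1) * 3 ^ (10 ^ (n - 1) * t)\<close> exceeds \<open>T (n + 1)\<close> by
  \<open>10 ^ n * t'\<close>, where \<open>t' = 2 * t * T (n + 1)\<close> modulo 10. As \<open>T (n + 1)\<close> ends in 7, this says
  \<open>t' = 4 * t\<close> modulo 10. Starting from \<open>T 3 - T 2 = 10 * 6\<close> modulo 100, the digit alternates
  between 6 for even \<open>n\<close> and 4 for odd \<open>n\<close> (\<open>tetration_step\<close>); later steps
  leave the last \<open>n\<close> digits alone.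

  It remains to see that the height \<open>N\<close> of Graham's number is odd
  (\<open>graham_odd_height\<close>). Every term \<open>3 \<up>\<^sup>k b\<close> with at least three arrows and \<open>b \<ge> 2\<close>
  unfolds to a tower whose height is itself an arrow expression in base 3, hence odd.
\<close>

section \<open>Decimal expansion of powers of three\<close>

text \<open>
  This is the binomial theorem cut after the linear term: since \<open>100\<close> divides \<open>10 ^ a\<close>, all further
  terms are absorbed. Two spare digits are kept because taking \<open>s = 10\<close> uses up one of them.
\<close>

lemma one_plus_power_of_ten_power:
  fixes a y s :: nat
  assumes "a \<ge> 2"
  shows "\<exists>r. (1 + 10 ^ a * y) ^ s = 1 + 10 ^ a * (s * y + 100 * r)"
proof (induction s)
  case 0
  show ?case by simp
next
  case (Suc s)
  then obtain r where r: "(1 + 10 ^ a * y) ^ s = 1 + 10 ^ a * (s * y + 100 * r)" by blast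
  obtain b where b: "a = b + 2" using assms le_Suc_ex by (metis add.commute)
  have "(1 + 10 ^ a * y) ^ Suc s = (1 + 10 ^ a * y) * (1 + 10 ^ a * (s * y + 100 * r))"
    by (simp only: power_Suc r)
  also have "\<dots> = 1 + 10 ^ a * (Suc s * y + 100 * (r + 10 ^ b * y * (s * y + 100 * r)))"
    by (simp add: b algebra_simps)
  finally show ?case by blast
qed

lemma three_power_two_times_power_of_ten:
  "\<exists>r. (3::nat) ^ (2 * 10 ^ Suc k) = 1 + 10 ^ (k + 2) * (4 + 10 * r)"
proof (induction k)
  case 0
  have "(3::nat) ^ (2 * 10 ^ Suc 0) = 1 + 10 ^ (0 + 2) * (4 + 10 * 3486784)" by simp
  then show ?case by blast
next
  case (Suc k)
  then obtain r where r: "(3::nat) ^ (2 * 10 ^ Suc k) = 1 + 10 ^ (k + 2) * (4 + 10 * r)" by blast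
  obtain r' where r': "(1 + 10 ^ (k + 2) * (4 + 10 * r)) ^ 10
      = 1 + 10 ^ (k + 2) * (10 * (4 + 10 * r) + 100 * r')"
    using one_plus_power_of_ten_power[of "k + 2" "4 + 10 * r" 10] by auto
  have "(3::nat) ^ (2 * 10 ^ Suc (Suc k)) = (3 ^ (2 * 10 ^ Suc k)) ^ 10"
    by (simp only: power_mult[symmetric]) (simp add: algebra_simps)
  also have "\<dots> = 1 + 10 ^ (Suc k + 2) * (4 + 10 * (r + r'))"
    by (simp only: r r') (simp add: algebra_simps)
  finally show ?case by blast
qed

lemma three_power_even:
  "\<exists>r. (3::nat) ^ (10 ^ Suc k * (2 * s)) = 1 + 10 ^ (k + 2) * (4 * s + 10 * r)"
proof -
  obtain r where r: "(3::nat) ^ (2 * 10 ^ Suc k) = 1 + 10 ^ (k + 2) * (4 + 10 * r)"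
    using three_power_two_times_power_of_ten by blast
  obtain r' where r': "(1 + 10 ^ (k + 2) * (4 + 10 * r)) ^ s
      = 1 + 10 ^ (k + 2) * (s * (4 + 10 * r) + 100 * r')"
    using one_plus_power_of_ten_power[of "k + 2" "4 + 10 * r" s] by auto
  have "(3::nat) ^ (10 ^ Suc k * (2 * s)) = (3 ^ (2 * 10 ^ Suc k)) ^ s"
    by (simp only: power_mult[symmetric]) (simp add: algebra_simps)
  also have "\<dots> = 1 + 10 ^ (k + 2) * (4 * s + 10 * (s * r + 10 * r'))"
    by (simp only: r r') (simp add: algebra_simps)
  finally show ?thesis by blast
qed

section \<open>Differences of consecutive towers\<close>

lemma tetration_Suc: "n \<ge> 1 \<Longrightarrow> tetration a (Suc n) = a ^ tetration a n"
  by (cases n) auto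

lemma tetration_3_add_3: "tetration 3 (n + 3) = 3 ^ tetration 3 (n + 2)"
proof -
  have "n + 3 = Suc (n + 2)" by simp
  then show ?thesis using tetration_Suc[of "n + 2" 3] by (simp only:)
qed

lemma three_power_mod_20: "(3::nat) ^ (4 * q + 3) mod 20 = 7"
proof -
  have "((3::nat) ^ 4) ^ q mod 20 = ((3 ^ 4) mod 20) ^ q mod 20"
    by (rule power_mod[symmetric])
  then have "((3::nat) ^ 4) ^ q mod 20 = 1" by simp
  then have "((3::nat) ^ 4) ^ q * 27 mod 20 = 7"
    using mod_mult_left_eq[of "((3::nat) ^ 4) ^ q" 20 27] by simp
  then show ?thesis by (simp add: power_add power_mult)
qed

text \<open>
  The modulus 20 rather than 10 makes the induction work: the last digit of a power of 3 is decided by the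
  exponent modulo 4.
\<close>

lemma tetration_mod_20: "tetration 3 (n + 2) mod 20 = 7"
proof (induction n)
  case 0
  show ?case by (simp add: numeral_2_eq_2)
next
  case (Suc n)
  have "tetration 3 (n + 2) = 4 * (5 * (tetration 3 (n + 2) div 20) + 1) + 3"
    using Suc div_mult_mod_eq[of "tetration 3 (n + 2)" 20] by simp
  then show ?case
    using three_power_mod_20[of "5 * (tetration 3 (n + 2) div 20) + 1"] by simp
qed

text \<open>
  The key fact. The digit \<open>t\<close> moves to \<open>14 * t\<close> modulo 10 at each step, where 7 is the last digit
  of the tower and 2 comes from the expansion of powers of 3; thus 6 and 4 are exchanged.
  The recursion needs a factor 10 in the exponent, so it starts at height 2.
\<close>

lemma tetration_step:
  "\<exists>q. tetration 3 (n + 3) =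
     tetration 3 (n + 2) + 10 ^ (n + 1) * (10 * q + (if even n then 6 else 4))"
proof (induction n)
  case 0
  have "tetration 3 (0 + 2) = 27" by (simp add: numeral_2_eq_2)
  then have "tetration 3 (0 + 3) = tetration 3 (0 + 2) + 10 ^ (0 + 1) * (10 * 76255974849 + 6)"
    using tetration_3_add_3[of 0] by simp
  then show ?case by fastforce
next
  case (Suc n)
  define c :: nat where "c = (if even n then 3 else 2)"
  define T where "T = tetration 3 (n + 3)"
  have height: "Suc n + 2 = n + 3" "Suc n + 1 = n + 2" by simp_all
  obtain q where q: "T = tetration 3 (n + 2) + 10 ^ Suc n * (2 * (5 * q + c))"
    using Suc by (auto simp: c_def T_def split: if_splits)
  obtain r where r: "(3::nat) ^ (10 ^ Suc n * (2 * (5 * q + c)))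
      = 1 + 10 ^ (n + 2) * (4 * (5 * q + c) + 10 * r)"
    using three_power_even by blast
  have "T mod 20 = 7" using tetration_mod_20[of "Suc n"] by (simp only: T_def height)
  then obtain p where p: "T = 20 * p + 7"
    using div_mult_mod_eq[of T 20] by (metis mult.commute)
  have "tetration 3 (Suc n + 3) = 3 ^ T"
    using tetration_Suc[of "n + 3" 3] by (simp add: T_def)
  also have "\<dots> = 3 ^ tetration 3 (n + 2) * 3 ^ (10 ^ Suc n * (2 * (5 * q + c)))"
    by (simp only: q power_add)
  also have "3 ^ tetration 3 (n + 2) = T"
    by (simp only: T_def tetration_3_add_3)
  also have "T * 3 ^ (10 ^ Suc n * (2 * (5 * q + c)))
      = T + 10 ^ (n + 2) * (T * (4 * (5 * q + c) + 10 * r))"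
    unfolding r by (simp add: algebra_simps)
  also have "T * (4 * (5 * q + c) + 10 * r)
      = 10 * (2 * T * q + T * r + 8 * p * c) + 28 * c"
    unfolding p by (simp add: algebra_simps)
  also have "28 * c = 10 * (if even n then 8 else 5) + (if even (Suc n) then 6 else 4)"
    by (simp add: c_def)
  finally have "tetration 3 (Suc n + 3) = T + 10 ^ (n + 2) *
      (10 * (2 * T * q + T * r + 8 * p * c + (if even n then 8 else 5))
        + (if even (Suc n) then 6 else 4))"
    by (simp only: add_mult_distrib2 add.assoc)
  then show ?case
    using height by (auto simp only: T_def)
qed

lemma tetration_add_odd:
  assumes "odd N" "N \<ge> 2" "c \<ge> 1"
  shows "\<exists>q. tetration 3 (N + c) = tetration 3 N + 10 ^ (N - 1) * (10 * q + 4)"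
  using \<open>c \<ge> 1\<close>
proof (induction c rule: dec_induct)
  case base
  obtain n where n: "N = n + 2" using assms(2) le_Suc_ex by (metis add.commute)
  then have "N + 1 = n + 3" "N - 1 = n + 1" "odd n" using assms(1) by auto
  then show ?case using tetration_step[of n] n by (auto simp only: if_False)
next
  case (step c)
  then obtain q where q: "tetration 3 (N + c) = tetration 3 N + 10 ^ (N - 1) * (10 * q + 4)"
    by blast
  have "\<exists>n. N + c = n + 2 \<and> n + 1 = (N - 1) + 1 + (c - 1)"
    using assms(2) step.hyps by (intro exI[of _ "N + c - 2"]) auto
  then obtain n where n: "N + c = n + 2" "n + 1 = (N - 1) + 1 + (c - 1)" by blast
  have height: "N + Suc c = n + 3" using n(1) by simp
  obtain x where "tetration 3 (n + 3) = tetration 3 (n + 2) + 10 ^ (n + 1) * x"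
    using tetration_step[of n] by blast
  then have "tetration 3 (N + Suc c) = tetration 3 (N + c) + 10 ^ (n + 1) * x"
    by (simp only: height n(1))
  also have "(10::nat) ^ (n + 1) = 10 ^ (N - 1) * 10 * 10 ^ (c - 1)"
    by (simp only: n(2) power_add power_one_right)
  also have "tetration 3 (N + c) + 10 ^ (N - 1) * 10 * 10 ^ (c - 1) * x
      = tetration 3 N + 10 ^ (N - 1) * (10 * (q + 10 ^ (c - 1) * x) + 4)"
    unfolding q by (simp add: algebra_simps)
  finally have "tetration 3 (N + Suc c)
      = tetration 3 N + 10 ^ (N - 1) * (10 * (q + 10 ^ (c - 1) * x) + 4)" .
  then show ?case by blast
qed

section \<open>The height of Graham's number\<close>

lemma up_arrow_odd_ge_3:
  assumes "odd a" "a \<ge> 3" "k \<ge> 1" "b \<ge> 1"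
  shows "odd (up_arrow a k b) \<and> up_arrow a k b \<ge> 3"
  using assms
proof (induction a k b rule: up_arrow.induct)
  case (1 a b)
  then show ?case using self_le_power[of a b] by auto
next
  case (3 a k b)
  have "odd (up_arrow a (Suc (Suc k)) (Suc b)) \<and> 3 \<le> up_arrow a (Suc (Suc k)) (Suc b)"
    using "3.IH"(1) "3.prems" by simp
  then show ?case using "3.IH"(2) "3.prems" by simp
qed auto

lemma up_arrow_2_eq_tetration:
  "up_arrow a (Suc (Suc 0)) (Suc b) = tetration a (Suc b)"
  by (induction b) auto

text \<open>
  With three arrows, one unfolding gives \<open>3 \<up>\<^sup>2 M\<close> where \<open>M\<close> is an arrow expression and so
  odd; with more arrows, each unfolding removes one arrow. The condition \<open>b \<ge> 2\<close> excludes the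
  degenerate tower 3 of height 1 and is preserved by unfolding.
\<close>

lemma up_arrow_3_odd_height:
  assumes "b \<ge> 2"
  shows "\<exists>M. odd M \<and> M \<ge> 2 \<and> up_arrow 3 (Suc (Suc (Suc k))) b = tetration 3 M"
  using assms
proof (induction k arbitrary: b)
  case 0
  then obtain j where j: "b = Suc (Suc j)" by (metis One_nat_def Suc_1 Suc_le_D Suc_le_mono)
  define M where "M = up_arrow 3 (Suc (Suc (Suc 0))) (Suc j)"
  have M: "odd M" "M \<ge> 3" using up_arrow_odd_ge_3[of 3] by (auto simp: M_def)
  then obtain m where m: "M = Suc m" by (cases M) auto
  have "up_arrow 3 (Suc (Suc (Suc 0))) b = up_arrow 3 (Suc (Suc 0)) M"
    unfolding j M_def by (rule up_arrow.simps)
  also have "\<dots> = tetration 3 M" unfolding m by (rule up_arrow_2_eq_tetration)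
  finally show ?case using M by (intro exI[of _ M]) auto
next
  case (Suc k)
  then obtain j where j: "b = Suc (Suc j)" by (metis One_nat_def Suc_1 Suc_le_D Suc_le_mono)
  define B where "B = up_arrow 3 (Suc (Suc (Suc (Suc k)))) (Suc j)"
  have "B \<ge> 2" using up_arrow_odd_ge_3[of 3 "Suc (Suc (Suc (Suc k)))" "Suc j"] by (auto simp: B_def)
  moreover have "up_arrow 3 (Suc (Suc (Suc (Suc k)))) b = up_arrow 3 (Suc (Suc (Suc k))) B"
    unfolding j B_def by (rule up_arrow.simps)
  ultimately show ?case using Suc.IH[of B] by metis
qed

lemma graham_seq_eq_up_arrow: "\<exists>k\<ge>3. graham_seq (Suc n) = up_arrow 3 k 3"
proof (induction n)
  case 0
  have "graham_seq (Suc 0) = up_arrow 3 4 3" by (rule graham_seq.simps)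
  then show ?case by (intro exI[of _ 4]) auto
next
  case (Suc n)
  then have "graham_seq (Suc n) \<ge> 3" using up_arrow_odd_ge_3[of 3 _ 3] by fastforce
  then show ?case using graham_seq.simps(2) by blast
qed

lemma graham_odd_height: "\<exists>M. odd M \<and> M \<ge> 2 \<and> graham = tetration 3 M"
proof -
  have "(64::nat) = Suc 63" by simp
  then obtain k where k: "k \<ge> 3" "graham = up_arrow 3 k 3"
    unfolding graham_def using graham_seq_eq_up_arrow[of 63] by metis
  obtain j where "k = Suc (Suc (Suc j))" using k(1) le_Suc_ex[of 3 k] by auto
  then show ?thesis using k(2) up_arrow_3_odd_height[of 3 j] by auto
qed

section \<open>Digits\<close>

lemma digit_mult_power_of_ten: "digit N (10 ^ (N - 1) * x) = x mod 10"
  by (simp add: digit_def)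

lemma digit_add_mult_power_of_ten:
  "digit N (x + 10 ^ (N - 1) * y) = (digit N x + y) mod 10"
  by (simp add: digit_def mod_add_right_eq add.commute)

theorem mainTheorem2:
  fixes N c d d' :: nat
  assumes "N = slog3 graham"
    and "c \<ge> 1"
    and "d = digit N graham"
    and "d' = digit N (tetration 3 (N + c))"
  shows "[int (tetration 3 (N + c)) - int graham = 4 * 10 ^ (N - 1)] (mod 10 ^ N)
    \<and> digit N (3 ^ graham - graham) = 4
    \<and> (if d \<in> {6, 7, 8, 9} then int d - int d' = 6 else int d - int d' = - 4)"
proof -
  obtain M where M: "odd M" "M \<ge> 2" "graham = tetration 3 M" using graham_odd_height by blast
  have N: "odd N" "N \<ge> 2" "graham = tetration 3 N"
    using M slog3_tetration[of M] assms(1) by auto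
  obtain q where q: "tetration 3 (N + c) = graham + 10 ^ (N - 1) * (10 * q + 4)"
    using tetration_add_odd[OF N(1,2) assms(2)] N(3) by auto
  obtain p where p: "tetration 3 (N + 1) = graham + 10 ^ (N - 1) * (10 * p + 4)"
    using tetration_add_odd[OF N(1,2), of 1] N(3) by auto
  have "int (tetration 3 (N + c)) - int graham = 4 * 10 ^ (N - 1) + 10 ^ N * int q"
    using N(2) unfolding q by (cases N) (simp_all add: algebra_simps)
  then have i: "[int (tetration 3 (N + c)) - int graham = 4 * 10 ^ (N - 1)] (mod 10 ^ N)"
    by (simp add: cong_def)
  have "3 ^ graham = tetration 3 (N + 1)" using tetration_Suc[of N 3] N by simp
  then have "3 ^ graham - graham = 10 ^ (N - 1) * (10 * p + 4)" using p by simp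
  then have "digit N (3 ^ graham - graham) = (10 * p + 4) mod 10"
    by (simp only: digit_mult_power_of_ten)
  then have ii: "digit N (3 ^ graham - graham) = 4" by simp
  have "d' = (d + (10 * q + 4)) mod 10"
    unfolding assms(3,4) q by (rule digit_add_mult_power_of_ten)
  also have "\<dots> = (d + 4) mod 10"
    using mod_mult_self2[of "d + 4" 10 q] by (simp add: ac_simps)
  finally have d': "d' = (d + 4) mod 10" .
  have "d < 10" unfolding assms(3) digit_def by simp
  then have "d \<in> {0, 1, 2, 3, 4, 5, 6, 7, 8, 9}" by auto
  then have "if d \<in> {6, 7, 8, 9} then int d - int d' = 6 else int d - int d' = - 4"
    unfolding d' by auto
  with i ii show ?thesis by blast
qed

end
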